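(* Let $K$ be a field and let $\Theta$ be a block of polynomials over $K$. If $\Theta$ intersects its self-image, i.e. $\Theta\cap\mathcal F(\Theta)\neq\emptyset$, then $\Theta$ contains a polynomial which is a right-left wedge invariant of two polynomials in the same block; that is, there exist $\theta, g_1, g_2\in\Theta$ such that $g_1\wedge\theta=\theta$ and $\theta\wedge g_2=\theta$.
   Context: Let $K$ be a field. All irreducible polynomials considered are monic over $K$ and separable (distinct roots). For monic irreducible $f,g$ over $K$, $f\wedge g$ (the paper's "wedge" of $f$ and $g$) denotes the minimal polynomial over $K$ of $f(\alpha)$, where $\alpha$ is a root of $g$; it does not depend on the choice of $\alpha$. If $f\wedge g=g$ then $g$ is called a right wedge invariant of $f$; if $g\wedge f=g$ then $g$ is called a left wedge invariant of $f$. For $b\in K$ write $f_b^+(x):=f(x+b)$. The block of $f$ is $\Theta_f=\{f_b^+ : b\in K\}$; a block is any set of this form with $f$ monic irreducible over $K$. The self-image $\mathcal F(\Theta)$ of a block $\Theta$ is the set of all polynomials $f\wedge f_b^+$ with $f\in\Theta$ and $b\in K$, $b\neq 0$. *)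

theory Defs
  imports "HOL-Algebra.Algebraic_Closure_Type"
begin

text \<open>The field \<open>K\<close> is the type \<open>'a::field\<close>; roots are taken in the algebraic closure
  \<^typ>\<open>'a alg_closure\<close>. Several constants are qualified because HOL-Algebra reuses their names
  for its locale-based polynomials.\<close>

definition ac_poly :: "'a::field poly \<Rightarrow> 'a alg_closure poly"
  where "ac_poly p = map_poly to_ac p"

abbreviation ac_eval :: "'a::field poly \<Rightarrow> 'a alg_closure \<Rightarrow> 'a alg_closure"
  where "ac_eval p x \<equiv> poly (ac_poly p) x"

definition is_minimal_poly :: "'a::field alg_closure \<Rightarrow> 'a poly \<Rightarrow> bool"
  where "is_minimal_poly x p \<longleftrightarrow>
    Polynomial.lead_coeff p = 1 \<and> ac_eval p x = 0 \<and>
    (\<forall>q. q \<noteq> 0 \<and> ac_eval q x = 0 \<longrightarrow> Polynomial.degree p \<le> Polynomial.degree q)"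

definition minimal_poly :: "'a::field alg_closure \<Rightarrow> 'a poly"
  where "minimal_poly x = (THE p. is_minimal_poly x p)"

text \<open>Well defined and independent of the chosen root for irreducible \<open>g\<close>: see
  \<open>wedge_eq_minimal_poly\<close> below. For constant nonzero \<open>g\<close> the value is unspecified.\<close>

definition wedge :: "'a::field poly \<Rightarrow> 'a poly \<Rightarrow> 'a poly"  (infixl \<open>\<curlywedge>\<close> 70)
  where "f \<curlywedge> g = minimal_poly (ac_eval f (SOME \<alpha>. ac_eval g \<alpha> = 0))"

definition right_wedge_invariant :: "'a::field poly \<Rightarrow> 'a poly \<Rightarrow> bool"
  where "right_wedge_invariant g f \<longleftrightarrow> f \<curlywedge> g = g"

definition left_wedge_invariant :: "'a::field poly \<Rightarrow> 'a poly \<Rightarrow> bool"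
  where "left_wedge_invariant g f \<longleftrightarrow> g \<curlywedge> f = g"

text \<open>The standing assumption on polynomials: monic, irreducible over \<open>K\<close>, and separable,
  i.e. all roots in the algebraic closure are simple.\<close>

definition admissible :: "'a::field poly \<Rightarrow> bool"
  where "admissible f \<longleftrightarrow>
    Polynomial.lead_coeff f = 1 \<and> Factorial_Ring.irreducible f \<and> rsquarefree (ac_poly f)"

definition shift :: "'a::field poly \<Rightarrow> 'a \<Rightarrow> 'a poly"
  where "shift f b = f \<circ>\<^sub>p [:b, 1:]"

definition block_of :: "'a::field poly \<Rightarrow> 'a poly set"
  where "block_of f = range (shift f)"

definition is_block :: "'a::field poly set \<Rightarrow> bool"
  where "is_block \<Theta> \<longleftrightarrow> (\<exists>f. admissible f \<and> \<Theta> = block_of f)"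

definition self_image :: "'a::field poly set \<Rightarrow> 'a poly set"
  where "self_image \<Theta> = {f \<curlywedge> shift f b | f b. f \<in> \<Theta> \<and> b \<noteq> 0}"

lemma ac_poly_0 [simp]: "ac_poly 0 = 0"
  by (simp add: ac_poly_def)

lemma ac_poly_pCons [simp]: "ac_poly (pCons a p) = pCons (to_ac a) (ac_poly p)"
  by (cases "p = 0 \<and> a = 0") (auto simp: ac_poly_def map_poly_pCons)

lemma ac_eval_add [simp]: "ac_eval (p + q) x = ac_eval p x + ac_eval q x"
proof -
  have "ac_poly (p + q) = ac_poly p + ac_poly q"
    by (rule poly_eqI) (simp add: ac_poly_def coeff_map_poly)
  thus ?thesis by simp
qed

lemma ac_eval_diff [simp]: "ac_eval (p - q) x = ac_eval p x - ac_eval q x"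
  by (metis ac_eval_add add_diff_cancel_right' diff_add_cancel)

lemma ac_eval_smult [simp]: "ac_eval (Polynomial.smult c p) x = to_ac c * ac_eval p x"
  by (induction p) (simp_all add: algebra_simps)

lemma ac_eval_mult [simp]: "ac_eval (p * q) x = ac_eval p x * ac_eval q x"
  by (induction p) (simp_all add: algebra_simps)

lemma ac_eval_pcompose: "ac_eval (p \<circ>\<^sub>p q) x = ac_eval p (ac_eval q x)"
  by (induction p) (simp_all add: pcompose_pCons)

lemma ex_is_minimal_poly: "\<exists>p. is_minimal_poly x p"
proof -
  obtain r :: "'a poly" where "r \<noteq> 0 \<and> ac_eval r x = 0"
    using alg_closure_algebraic[of x] unfolding ac_poly_def by metis
  then obtain p where p: "p \<noteq> 0" "ac_eval p x = 0"
    "\<And>q. q \<noteq> 0 \<and> ac_eval q x = 0 \<Longrightarrow> Polynomial.degree p \<le> Polynomial.degree q"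
    using ex_has_least_nat[of "\<lambda>r. r \<noteq> 0 \<and> ac_eval r x = 0" r Polynomial.degree] by blast
  have "is_minimal_poly x (Polynomial.smult (inverse (Polynomial.lead_coeff p)) p)"
    unfolding is_minimal_poly_def using p by simp
  thus ?thesis ..
qed

lemma is_minimal_poly_dvd:
  assumes "is_minimal_poly x p" "ac_eval q x = 0"
  shows "p dvd q"
proof -
  have "p \<noteq> 0" using assms(1) by (auto simp: is_minimal_poly_def)
  have "ac_eval (q mod p) x = 0"
    using assms unfolding minus_div_mult_eq_mod[symmetric] by (simp add: is_minimal_poly_def)
  hence "q mod p = 0"
    using assms(1) degree_mod_less[OF \<open>p \<noteq> 0\<close>, of q]
    by (meson is_minimal_poly_def not_le)
  thus ?thesis by (simp add: dvd_eq_mod_eq_0)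
qed

lemma is_minimal_poly_unique:
  assumes "is_minimal_poly x p" "is_minimal_poly x q"
  shows "p = q"
proof -
  have nz: "p \<noteq> 0" "q \<noteq> 0" using assms by (auto simp: is_minimal_poly_def)
  have "p dvd q"
    using assms(2) is_minimal_poly_dvd[OF assms(1)] by (simp add: is_minimal_poly_def)
  then obtain r where r: "q = p * r" by (elim dvdE)
  have deg: "Polynomial.degree p = Polynomial.degree q"
    by (rule antisym) (use assms nz in \<open>unfold is_minimal_poly_def, blast+\<close>)
  hence "Polynomial.degree r = 0" using r nz by (auto simp: degree_mult_eq)
  then obtain c where "r = [:c:]" by (rule degree_eq_zeroE)
  moreover have "Polynomial.lead_coeff r = 1"
    using r assms by (simp add: is_minimal_poly_def lead_coeff_mult)
  ultimately show ?thesis using r by simp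
qed

lemma minimal_poly_eq: "is_minimal_poly x p \<Longrightarrow> minimal_poly x = p"
  unfolding minimal_poly_def using is_minimal_poly_unique by blast

lemma is_minimal_poly_minimal_poly: "is_minimal_poly x (minimal_poly x)"
  using ex_is_minimal_poly minimal_poly_eq by metis

lemma irreducible_common_root:
  assumes "Factorial_Ring.irreducible g" "ac_eval g \<alpha> = 0" "ac_eval g \<beta> = 0" "ac_eval q \<alpha> = 0"
  shows "ac_eval q \<beta> = 0"
proof -
  let ?m = "minimal_poly \<alpha>"
  have m: "is_minimal_poly \<alpha> ?m" by (rule is_minimal_poly_minimal_poly)
  have "\<not> ?m dvd 1"
  proof
    assume "?m dvd 1"
    then obtain r where "1 = ?m * r" by (elim dvdE)
    moreover have "ac_eval (?m * r) \<alpha> = 0" using m by (simp add: is_minimal_poly_def)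
    ultimately have "ac_eval 1 \<alpha> = 0" by simp
    thus False by (simp add: one_pCons)
  qed
  hence "g dvd ?m" using is_minimal_poly_dvd[OF m assms(2)] irreducibleD'[OF assms(1)] by blast
  hence "g dvd q" using is_minimal_poly_dvd[OF m assms(4)] dvd_trans by blast
  thus ?thesis using assms(3) by (auto elim!: dvdE)
qed

lemma wedge_eq_minimal_poly:
  assumes "Factorial_Ring.irreducible g" "ac_eval g \<alpha> = 0"
  shows "f \<curlywedge> g = minimal_poly (ac_eval f \<alpha>)"
proof -
  define \<beta> where "\<beta> = (SOME \<alpha>. ac_eval g \<alpha> = 0)"
  have \<beta>: "ac_eval g \<beta> = 0" unfolding \<beta>_def using assms(2) by (rule someI)
  have "ac_eval q (ac_eval f \<beta>) = 0 \<longleftrightarrow> ac_eval q (ac_eval f \<alpha>) = 0" for q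
    using irreducible_common_root[OF assms \<beta>, of "q \<circ>\<^sub>p f"]
      irreducible_common_root[OF assms(1) \<beta> assms(2), of "q \<circ>\<^sub>p f"]
    by (auto simp: ac_eval_pcompose)
  hence "is_minimal_poly (ac_eval f \<beta>) = is_minimal_poly (ac_eval f \<alpha>)"
    by (intro ext) (simp add: is_minimal_poly_def)
  thus ?thesis unfolding wedge_def minimal_poly_def \<beta>_def[symmetric] by simp
qed

end

theory Submission
  imports Defs
begin

text \<open>Shifting both arguments of a wedge by the same element moves the root of the right argument
  and the left argument in opposite directions, so the wedge is unchanged. Hence if
  \<open>f \<curlywedge> shift f b = shift f c\<close>, then shifting by \<open>c - b\<close> makes the right argument
  equal to \<open>shift f c\<close>, and shifting by \<open>c\<close> does so for the left one.\<close>

lemma shift_shift: "shift (shift f a) b = shift f (a + b)"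
proof -
  have "[:a, 1:] \<circ>\<^sub>p [:b, 1:] = [:a + b, 1:]"
    by (simp add: pcompose_pCons)
  then show ?thesis
    by (simp add: shift_def flip: pcompose_assoc)
qed

lemma shift_0 [simp]: "shift f 0 = f"
  by (simp add: shift_def pcompose_idR)

lemma shift_mult: "shift (f * g) b = shift f b * shift g b"
  by (simp add: shift_def pcompose_mult)

text \<open>Substitution of \<open>x + b\<close> is multiplicative and fixes \<open>1\<close>, so an
  inverse of \<open>f\<close> is carried to an inverse of \<open>shift f b\<close>; the shift by
  \<open>- b\<close> gives the converse.\<close>

lemma is_unit_shift_iff [simp]: "shift f b dvd 1 \<longleftrightarrow> f dvd 1"
proof -
  have "shift p c dvd 1" if "p dvd 1" for p :: "'a poly" and c
    using that by (metis dvd_def shift_mult shift_def pcompose_1)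
  from this[of f b] this[of "shift f b" "- b"] show ?thesis
    by (auto simp: shift_shift)
qed

text \<open>The shift by \<open>- b\<close> undoes the shift by \<open>b\<close>, so any
  factorization of \<open>shift f b\<close> pulls back to one of \<open>f\<close> with the same
  units.\<close>

lemma irreducible_shift:
  assumes "Factorial_Ring.irreducible f"
  shows "Factorial_Ring.irreducible (shift f b)"
proof (rule Factorial_Ring.irreducibleI)
  show "shift f b \<noteq> 0"
    using assms by (metis shift_shift add.right_inverse shift_0 shift_def pcompose_0
        Factorial_Ring.irreducible_def)
  show "\<not> shift f b dvd 1"
    using assms by (simp add: Factorial_Ring.irreducible_def)
next
  fix p q
  assume "shift f b = p * q"
  then have "f = shift p (- b) * shift q (- b)"
    by (metis shift_mult shift_shift add.right_inverse shift_0)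
  then show "p dvd 1 \<or> q dvd 1"
    using assms by (metis Factorial_Ring.irreducibleD is_unit_shift_iff)
qed

lemma ac_eval_shift: "ac_eval (shift f b) x = ac_eval f (x + to_ac b)"
  by (simp add: shift_def ac_eval_pcompose add.commute)

lemma ex_ac_root_of_irreducible:
  assumes "Factorial_Ring.irreducible g"
  shows "\<exists>\<alpha>. ac_eval g \<alpha> = 0"
proof -
  have "Polynomial.degree g \<noteq> 0"
    using assms by (auto simp: Factorial_Ring.irreducible_def is_unit_iff_degree)
  then have "Polynomial.degree (ac_poly g) > 0"
    by (simp add: ac_poly_def degree_map_poly)
  then show ?thesis
    by (rule alg_closed_imp_poly_has_root)
qed

lemma wedge_shift_shift:
  assumes "Factorial_Ring.irreducible g"
  shows "shift f d \<curlywedge> shift g d = f \<curlywedge> g"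
proof -
  obtain \<alpha> where \<alpha>: "ac_eval g \<alpha> = 0"
    using ex_ac_root_of_irreducible[OF assms] ..
  \<comment> \<open>At this root of \<open>shift g d\<close>, the polynomial
    \<open>shift f d\<close> takes the value of \<open>f\<close> at \<alpha>, so both wedges are the
    minimal polynomial of one element.\<close>
  then have "ac_eval (shift g d) (\<alpha> - to_ac d) = 0"
    by (simp add: ac_eval_shift)
  then have "shift f d \<curlywedge> shift g d = minimal_poly (ac_eval (shift f d) (\<alpha> - to_ac d))"
    by (intro wedge_eq_minimal_poly irreducible_shift assms)
  also have "\<dots> = f \<curlywedge> g"
    using wedge_eq_minimal_poly[OF assms \<alpha>] by (simp add: ac_eval_shift)
  finally show ?thesis .
qed

theorem theorem3p3:
  fixes \<Theta> :: "'a::field poly set"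
  assumes "is_block \<Theta>"
    and "\<Theta> \<inter> self_image \<Theta> \<noteq> {}"
  shows "\<exists>\<theta>\<in>\<Theta>. \<exists>g1\<in>\<Theta>. \<exists>g2\<in>\<Theta>.
    right_wedge_invariant \<theta> g1 \<and> left_wedge_invariant \<theta> g2"
proof -
  obtain f0 where f0: "Factorial_Ring.irreducible f0" and \<Theta>: "\<Theta> = block_of f0"
    using assms(1) by (auto simp: is_block_def admissible_def)
  obtain f b where f: "f \<in> \<Theta>" and wedge_in: "f \<curlywedge> shift f b \<in> \<Theta>"
    using assms(2) by (auto simp: self_image_def)
  obtain a where a: "f = shift f0 a"
    using f by (auto simp: \<Theta> block_of_def)
  obtain e where "f \<curlywedge> shift f b = shift f0 e"
    using wedge_in by (auto simp: \<Theta> block_of_def)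
  \<comment> \<open>Re-basing the block at \<open>f\<close> instead of \<open>f0\<close>:
    \<open>c = e - a\<close> works.\<close>
  then obtain c where c: "f \<curlywedge> shift f b = shift f c"
    by (metis a shift_shift add_diff_cancel_left' add.commute diff_add_cancel)
  have shift_in: "shift f d \<in> \<Theta>" for d
    by (simp add: a \<Theta> block_of_def shift_shift)
  have irr: "Factorial_Ring.irreducible (shift f b)"
    by (simp add: a f0 irreducible_shift)
  have "shift f (c - b) \<curlywedge> shift f c = shift f c"
    using wedge_shift_shift[OF irr, of f "c - b"] c by (simp add: shift_shift)
  moreover have "shift f c \<curlywedge> shift f (b + c) = shift f c"
    using wedge_shift_shift[OF irr, of f c] c by (simp add: shift_shift)
  \<comment> \<open>The witnesses are \<open>shift f c\<close> for \<theta>,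
    \<open>shift f (c - b)\<close> for \<open>g1\<close> and \<open>shift f (b + c)\<close> for
    \<open>g2\<close>.\<close>
  ultimately show ?thesis
    unfolding right_wedge_invariant_def left_wedge_invariant_def using shift_in by blast
qed

end
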